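(* Let $\alpha>1$, $\beta>0$, and let $\pi$ be the Gamma probability measure on $(0,+\infty)$ given by $\pi(\mathrm{d}r)=\frac{1}{\Gamma(\alpha)\beta^\alpha}r^{\alpha-1}\exp(-r/\beta)\,\mathrm{d}r$. Assume $q\ge1$. Then, for every $\lambda>0$, $$-\ln_q\left(\int_0^{+\infty}\exp_q\left(-\frac{\lambda}{r}\right)\pi(\mathrm{d}r)\right)=\inf_{\phi\in\mathfrak{F}'}\left\{\lambda\int_0^{+\infty}\{\phi(r)\}^q\frac1r\pi(\mathrm{d}r)+H_q(\phi)\right\},$$ and, for every $a\in(0,1]$, $$\underline{\mathrm{TsVaR}}_a=\inf_{\phi\in\mathfrak{F}}\left\{a^{q-1}\int_0^{+\infty}\{\phi(r)\}^q\frac1r\pi(\mathrm{d}r)\right\}.$$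
   Context: $\Gamma$ is the Gamma function. The $q$-exponential and $q$-logarithm are defined by $\exp_q(x)=(1+(1-q)x)^{\frac{1}{1-q}}$ for $1+(1-q)x>0$ if $q\ne1$, $\exp_1(x)=\exp(x)$; and $\ln_q(x)=\frac{x^{1-q}-1}{1-q}$ for $x>0$ if $q\neq1$, $\ln_1(x)=\ln(x)$. For $a\in(0,1]$ and $q\ge1$, the lower Tsallis Value-at-Risk is $$\underline{\mathrm{TsVaR}}_a=\sup_{\lambda>0}\left\{-\frac1\lambda\ln_q\left(\frac1a\int_0^{+\infty}\exp_q\left(-\frac{\lambda}{r}\right)\pi(\mathrm{d}r)\right)\right\}.$$ The set $\mathfrak{F}'$ consists of all measurable $\phi:(0,+\infty)\to(0,+\infty)$ with $\int_0^{+\infty}\phi(r)\pi(\mathrm{d}r)=1$. The Tsallis divergence of $\phi\in\mathfrak{F}'$ is $$H_q(\phi)=\frac{1}{1-q}\left(1-\int_0^{+\infty}\{\phi(r)\}^q\pi(\mathrm{d}r)\right)\quad(q\ne1),$$ and for $q=1$ it is understood as the limit (relative entropy) $H_1(\phi)=\int_0^{+\infty}\phi(r)\ln\phi(r)\,\pi(\mathrm{d}r)$. Integrals and $H_q(\phi)$ are allowed to take the value $+\infty$. Finally, for given $a\in(0,1]$ and $q$, $$\mathfrak{F}=\left\{\phi\in\mathfrak{F}'\;:\;H_q(\phi)\le-\ln_q(a)\right\}.$$ *)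

theory Defs
  imports "HOL-Analysis.Analysis"
begin

text \<open>
  Only meant for \<open>1 + (1 - q) * x > 0\<close> when \<open>q \<noteq> 1\<close>; outside this domain the value is an
  artefact of \<open>powr\<close>. For \<open>q \<ge> 1\<close> every \<open>x \<le> 0\<close> lies in the domain.
\<close>
definition qexp :: "real \<Rightarrow> real \<Rightarrow> real" where
  "qexp q x = (if q = 1 then exp x else (1 + (1 - q) * x) powr (1 / (1 - q)))"

text \<open>Only meant for \<open>x > 0\<close>.\<close>
definition qln :: "real \<Rightarrow> real \<Rightarrow> real" where
  "qln q x = (if q = 1 then ln x else (x powr (1 - q) - 1) / (1 - q))"

text \<open>
  The underlying space is the open half-line \<open>{0<..}\<close>, with the trace of the Borel sets.
\<close>
definition gamma_measure :: "real \<Rightarrow> real \<Rightarrow> real measure" where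
  "gamma_measure \<alpha> \<beta> = density (restrict_space lborel {0<..})
     (\<lambda>r. ennreal (1 / (Gamma \<alpha> * \<beta> powr \<alpha>) * r powr (\<alpha> - 1) * exp (- r / \<beta>)))"

text \<open>
  Functions are total, but only their values on \<open>space M\<close> (the half-line for
  \<^const>\<open>gamma_measure\<close>) are constrained or used.
\<close>
definition pos_densities :: "real measure \<Rightarrow> (real \<Rightarrow> real) set" where
  "pos_densities M =
     {\<phi> \<in> borel_measurable M. (\<forall>r\<in>space M. 0 < \<phi> r) \<and> (\<integral>\<^sup>+ r. ennreal (\<phi> r) \<partial>M) = 1}"

text \<open>
  The integral of \<open>\<phi> ln \<phi>\<close> is taken with values in the extended reals, as positive part minus
  negative part. The negative part is bounded by \<open>exp (-1)\<close>, so on a probability space the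
  subtracted integral is finite.
\<close>
definition tsallis_div :: "real measure \<Rightarrow> real \<Rightarrow> (real \<Rightarrow> real) \<Rightarrow> ereal" where
  "tsallis_div M q \<phi> =
     (if q = 1
      then enn2ereal (\<integral>\<^sup>+ r. ennreal (\<phi> r * ln (\<phi> r)) \<partial>M)
             - enn2ereal (\<integral>\<^sup>+ r. ennreal (- (\<phi> r * ln (\<phi> r))) \<partial>M)
      else ereal (1 / (1 - q)) * (1 - enn2ereal (\<integral>\<^sup>+ r. ennreal (\<phi> r powr q) \<partial>M)))"

definition pos_densities_le :: "real measure \<Rightarrow> real \<Rightarrow> real \<Rightarrow> (real \<Rightarrow> real) set" where
  "pos_densities_le M q a = {\<phi> \<in> pos_densities M. tsallis_div M q \<phi> \<le> ereal (- qln q a)}"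

text \<open>
  For \<open>q \<ge> 1\<close> the integrand takes values in \<open>{0<..<1}\<close> on the half-line, so the Bochner integral
  is a genuine one. The supremum is taken in the extended reals.
\<close>
definition lower_TsVaR :: "real measure \<Rightarrow> real \<Rightarrow> real \<Rightarrow> ereal" where
  "lower_TsVaR M q a =
     (SUP l\<in>{0<..}. ereal (- (1 / l) * qln q (1 / a * (\<integral>r. qexp q (- l / r) \<partial>M))))"

end

theory Submission
  imports Defs "HOL-Probability.Probability_Measure"
begin

text \<open>
  For \<open>l > 0\<close>, the penalised cost \<open>l * \<integral> \<phi>\<^sup>q / r + H\<^sub>q(\<phi>)\<close> is the integral of a function convex in \<open>\<phi>\<close>. Its
  tangent at the Gibbs density, which is proportional to \<open>exp\<^sub>q (- l / r)\<close>, has the same slope at every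
  \<open>r\<close>, so integrating the tangent bound shows that the Gibbs density is the minimiser; the minimum is
  \<open>- ln\<^sub>q \<integral> exp\<^sub>q (- l / r)\<close>.

  Since \<open>- ln\<^sub>q (z / a) = a\<^sup>q\<^sup>-\<^sup>1 (- ln\<^sub>q z - C)\<close> with \<open>C = - ln\<^sub>q a\<close>, the second identity is
  Lagrange duality for the minimisation of the cost under \<open>H\<^sub>q \<le> C\<close>. For \<open>a < 1\<close> the density \<open>1\<close> is a Slater
  point and there is a multiplier \<open>\<mu> \<ge> 0\<close>: for \<open>\<mu> > 0\<close> the supremum is attained at \<open>l = 1 / \<mu>\<close>, for
  \<open>\<mu> = 0\<close> it is approached as \<open>l \<rightarrow> \<infinity>\<close>. For \<open>a = 1\<close> it is approached as \<open>l \<rightarrow> 0\<close>, by dominated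
  convergence; this needs \<open>1 / r\<close> to be integrable, that is, \<open>\<alpha> > 1\<close>.
\<close>

subsection \<open>Pointwise inequalities\<close>

text \<open>The integrand of the Tsallis divergence plus a multiple of \<open>t - 1\<close>, which does not change the integral
  over a density and makes the integrand nonnegative, also at \<open>q = 1\<close>.\<close>

definition tsallis_gap :: "real \<Rightarrow> real \<Rightarrow> real" where
  "tsallis_gap q t = (if q = 1 then t * ln t - t + 1 else (t powr q - 1 - q * (t - 1)) / (q - 1))"

lemma powr_ge_tangent:
  fixes t m q :: real
  assumes "q \<ge> 1" "t > 0" "m > 0"
  shows "m powr q + q * m powr (q - 1) * (t - m) \<le> t powr q"
proof -
  have "(\<lambda>x. q * x powr (q - 1)) m * (t - m) \<le> t powr q - m powr q"
    by (rule f''_imp_f'[where C = "{0<..}" and f'' = "\<lambda>x. q * ((q - 1) * x powr (q - 2))"])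
       (use assms in \<open>auto intro!: derivative_eq_intros simp: algebra_simps\<close>)
  then show ?thesis by simp
qed

text \<open>The left-hand side is the tangent of \<open>x * ln x\<close> at \<open>m\<close>; the
  bound is \<open>ln x \<le> x - 1\<close> at \<open>x = m / t\<close>, multiplied by
  \<open>t\<close>.\<close>

lemma xlnx_ge_tangent:
  fixes t m :: real
  assumes "t > 0" "m > 0"
  shows "t * ln m + t - m \<le> t * ln t"
proof -
  have "t * (ln m - ln t) \<le> t * ((m - t) / t)"
    using assms ln_diff_le[of m t] by (intro mult_left_mono) auto
  also have "t * ((m - t) / t) = m - t" using assms by simp
  finally show ?thesis by (simp add: algebra_simps)
qed

lemma tsallis_gap_nonneg: "q \<ge> 1 \<Longrightarrow> t > 0 \<Longrightarrow> 0 \<le> tsallis_gap q t"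
  using powr_ge_tangent[of q t 1] xlnx_ge_tangent[of t 1] by (auto simp: tsallis_gap_def)

lemma tsallis_gap_1 [simp]: "tsallis_gap q 1 = 0"
  by (simp add: tsallis_gap_def)

lemma convex_on_tsallis_gap:
  assumes "q \<ge> 1"
  shows "convex_on {0<..} (tsallis_gap q)"
proof (cases "q = 1")
  case True
  have "convex_on {0<..} (\<lambda>t::real. t * ln t - t + 1)"
    by (rule f''_ge0_imp_convex[where f' = ln and f'' = "\<lambda>x. 1 / x"])
       (auto intro!: derivative_eq_intros)
  then show ?thesis using True by (simp add: tsallis_gap_def [abs_def])
next
  case False
  with assms have q: "q > 1" by simp
  have "convex_on {0<..} (\<lambda>t. (t powr q - 1 - q * (t - 1)) / (q - 1))"
    by (rule f''_ge0_imp_convex[where f' = "\<lambda>x. (q * x powr (q - 1) - q) / (q - 1)"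
          and f'' = "\<lambda>x. q * ((q - 1) * x powr (q - 2)) / (q - 1)"])
       (use q in \<open>auto intro!: DERIV_cdivide derivative_eq_intros simp: algebra_simps\<close>)
  then show ?thesis using False by (simp add: tsallis_gap_def [abs_def])
qed

section \<open>Bounds for the q-exponential and the q-logarithm\<close>

lemma qexp_gt_0: "q \<ge> 1 \<Longrightarrow> c \<ge> 0 \<Longrightarrow> 0 < qexp q (- c)"
proof -
  assume "q \<ge> 1" "c \<ge> 0"
  then have "0 \<le> (q - 1) * c" by simp
  then show ?thesis by (auto simp: qexp_def algebra_simps)
qed

text \<open>Together with \<open>qexp_le_1\<close>, this bounds
  \<open>(1 - qexp q (- (l * X r))) / l\<close> by \<open>X r\<close>, the majorant for dominated
  convergence as \<open>l\<close> tends to 0.\<close>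

lemma qexp_ge_add_one:
  assumes "q \<ge> 1" "c \<ge> 0"
  shows "1 - c \<le> qexp q (- c)"
proof (cases "q = 1")
  case True
  then show ?thesis using exp_ge_add_one_self[of "- c"] by (simp add: qexp_def)
next
  case False
  with assms have q: "q > 1" by simp
  define w where "w = 1 + (q - 1) * c"
  have w: "w > 0" using assms by (simp add: w_def add_pos_nonneg)
  have "1 - c = 1 + - (1 / (q - 1)) * (w - 1)" using q by (simp add: w_def)
  also have "\<dots> \<le> 1 + - (1 / (q - 1)) * ln w"
    using q w ln_le_minus_one[of w] by (simp add: divide_right_mono)
  also have "\<dots> \<le> exp (- (1 / (q - 1)) * ln w)" by (rule exp_ge_add_one_self)
  also have "\<dots> = qexp q (- c)"
    using q w by (simp add: qexp_def w_def powr_def algebra_simps divide_simps)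
  finally show ?thesis .
qed

lemma qexp_le_1:
  assumes "q \<ge> 1" "c \<ge> 0"
  shows "qexp q (- c) \<le> 1"
proof (cases "q = 1")
  case False
  with assms have q: "q > 1" by simp
  have "(1 + (q - 1) * c) powr (1 / (1 - q)) \<le> (1 + (q - 1) * c) powr 0"
    using assms q by (intro powr_mono) (auto simp: divide_simps)
  moreover have "(1 + (q - 1) * c) > 0" using assms by (simp add: add_pos_nonneg)
  ultimately show ?thesis using q by (simp add: qexp_def algebra_simps)
qed (use assms in \<open>simp add: qexp_def\<close>)

lemma qexp_DERIV_0: "(qexp q has_real_derivative 1) (at 0)"
proof (cases "q = 1")
  case True
  then have "qexp q = exp" by (simp add: qexp_def [abs_def])
  then show ?thesis by (auto intro!: derivative_eq_intros)
next
  case False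
  then have "qexp q = (\<lambda>x. (1 + (1 - q) * x) powr (1 / (1 - q)))" by (simp add: qexp_def [abs_def])
  then show ?thesis using False by (auto intro!: derivative_eq_intros)
qed

text \<open>For \<open>q > 1\<close> this combines \<open>ln z \<le> z - 1\<close>, reversed by the
  negative factor \<open>1 - q\<close>, with \<open>1 + x \<le> exp x\<close>. It yields
  \<open>dual l \<ge> 1 - Z l\<close> and the sign of the constraint level
  \<open>- qln q a\<close>.\<close>

lemma qln_le_minus_one:
  assumes "q \<ge> 1" "z > 0"
  shows "qln q z \<le> z - 1"
proof (cases "q = 1")
  case False
  with assms have q: "q > 1" by simp
  have "1 + (1 - q) * (z - 1) \<le> 1 + (1 - q) * ln z"
    using q assms ln_le_minus_one[of z] by simp
  also have "\<dots> \<le> exp ((1 - q) * ln z)" by (rule exp_ge_add_one_self)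
  finally have "1 + (1 - q) * (z - 1) \<le> z powr (1 - q)" using assms by (simp add: powr_def)
  then show ?thesis using q by (simp add: qln_def divide_simps algebra_simps)
qed (use assms ln_le_minus_one in \<open>simp add: qln_def\<close>)

text \<open>This is how the factor \<open>1 / a\<close> inside the risk measure turns into the
  prefactor of the cost and the level of the divergence constraint.\<close>

lemma qln_scale:
  assumes "a > 0" "z > 0"
  shows "- qln q (1 / a * z) = a powr (q - 1) * (- qln q z + qln q a)"
proof (cases "q = 1")
  case True
  then show ?thesis using assms by (simp add: qln_def ln_div)
next
  case False
  have "(1 / a * z) powr (1 - q) = a powr (q - 1) * z powr (1 - q)"
    using assms powr_minus_divide[of a "1 - q"] by (simp add: powr_divide)
  moreover have "a powr (q - 1) * a powr (1 - q) = 1"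
    using assms by (simp flip: powr_add)
  moreover have "a powr (q - 1) * (- qln q z + qln q a) =
      (a powr (q - 1) * a powr (1 - q) - a powr (q - 1) * z powr (1 - q)) / (1 - q)"
    using False by (simp add: qln_def diff_divide_distrib algebra_simps)
  ultimately show ?thesis
    using False by (simp add: qln_def minus_divide_left)
qed

text \<open>The right-hand side of the inequality is the tangent at \<open>qexp q (- c) / z\<close> of the left-hand
  side as a function of \<open>t\<close>; its slope does not depend on \<open>c\<close>.\<close>

lemma tsallis_young:
  assumes q: "q \<ge> 1" and c: "c \<ge> 0" and z: "z > 0" and t: "t > 0"
  defines "p \<equiv> qexp q (- c) / z" and "D \<equiv> - qln q z"
  shows "1 - p + D * (p + q * (t - p)) \<le> c * t powr q + tsallis_gap q t" (is ?le)
    and "c * p powr q + tsallis_gap q p = 1 - p + D * p" (is ?eq)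
proof -
  have p: "p > 0" using qexp_gt_0[OF q c] z by (simp add: p_def)
  show ?le ?eq
  proof (atomize (full), cases "q = 1")
    case True
    \<comment> \<open>For \<open>q = 1\<close> the left-hand side has slope \<open>c + ln p\<close>
      at \<open>t = p\<close>, which is thus equal to \<open>D\<close>.\<close>
    have lnp: "ln p = D - c"
      using z True by (simp add: p_def D_def qexp_def qln_def ln_div)
    show "?le \<and> ?eq"
      using xlnx_ge_tangent[OF t p] t p True unfolding lnp
      by (simp add: tsallis_gap_def lnp algebra_simps)
  next
    case False
    with q have q1: "q > 1" by simp
    define w where "w = 1 + (q - 1) * c"
    have w: "w > 0" using c q by (simp add: w_def add_pos_nonneg)
    have K: "z powr (1 - q) = 1 + (q - 1) * D"
      using q1 by (simp add: D_def qln_def) (simp add: divide_simps algebra_simps)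
    have "p powr (q - 1) = qexp q (- c) powr (q - 1) / z powr (q - 1)"
      using z qexp_gt_0[OF q c] by (simp add: p_def powr_divide)
    also have "qexp q (- c) powr (q - 1) = w powr (- 1)"
    proof -
      have "1 / (1 - q) * (q - 1) = - 1" using q1 by (simp add: divide_simps)
      moreover have "qexp q (- c) = w powr (1 / (1 - q))"
        using q1 by (simp add: qexp_def w_def algebra_simps)
      ultimately show ?thesis by (simp only: powr_powr)
    qed
    also have "w powr (- 1) / z powr (q - 1) = z powr (1 - q) / w"
      using w powr_minus_divide[of z "q - 1"] by (simp add: powr_minus_divide)
    \<comment> \<open>Here \<open>c\<close> cancels. The slope at \<open>p\<close> is
      \<open>q * (w * p powr (q - 1) - 1) / (q - 1)\<close>, hence \<open>q * D\<close>.\<close>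
    finally have pw: "w * p powr (q - 1) = 1 + (q - 1) * D" using w K by simp
    have pq: "p powr q = p * p powr (q - 1)" using p by (simp add: powr_mult_base)
    have wp: "w * p powr q = (1 + (q - 1) * D) * p" using pw pq by (simp add: mult.left_commute mult.commute)
    have eq: "c * s powr q + tsallis_gap q s = (w * s powr q - 1 - q * (s - 1)) / (q - 1)" for s
      using q1 by (simp add: tsallis_gap_def w_def field_simps)
    have "w * (p powr q + q * p powr (q - 1) * (t - p)) \<le> w * t powr q"
      using w powr_ge_tangent[OF q t p] by simp
    then have "(1 + (q - 1) * D) * p + q * (w * p powr (q - 1)) * (t - p) \<le> w * t powr q"
      using wp by (simp add: algebra_simps)
    then have le: "(1 + (q - 1) * D) * (p + q * (t - p)) \<le> w * t powr q"
      unfolding pw by (simp add: algebra_simps)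
    have "1 - p + D * (p + q * (t - p)) = ((1 + (q - 1) * D) * (p + q * (t - p)) - 1 - q * (t - 1)) / (q - 1)"
      using q1 by (simp add: field_simps)
    also have "\<dots> \<le> (w * t powr q - 1 - q * (t - 1)) / (q - 1)"
      using le q1 by (intro divide_right_mono) auto
    finally have ?le by (simp add: eq)
    moreover have ?eq
      unfolding eq wp using q1 by (simp add: field_simps)
    ultimately show "?le \<and> ?eq" ..
  qed
qed

text \<open>A supporting line in the plane. A point with \<open>h > C\<close> asks for
  \<open>\<mu> \<ge> (v - g) / (h - C)\<close>, one with \<open>h < C\<close> for
  \<open>\<mu> \<le> (g - v) / (C - h)\<close>. By convexity no lower bound exceeds an upper one, so
  the supremum of the lower bounds meets all requirements.\<close>

lemma convex_lagrange_multiplier: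
  fixes S :: "(real \<times> real) set"
  assumes S: "convex S" and v: "\<And>g h. (g, h) \<in> S \<Longrightarrow> h \<le> C \<Longrightarrow> v \<le> g"
    and slater: "(g0, h0) \<in> S" "h0 < C"
  shows "\<exists>\<mu>\<ge>0. \<forall>g h. (g, h) \<in> S \<longrightarrow> v \<le> g + \<mu> * (h - C)"
proof -
  \<comment> \<open>Inserting 0 makes the set nonempty and its supremum nonnegative.\<close>
  define A where "A = insert 0 {(v - g) / (h - C) | g h. (g, h) \<in> S \<and> h > C}"
  define \<mu> where "\<mu> = Sup A"
  have ub: "x \<le> (g1 - v) / (C - h1)" if "x \<in> A" and 1: "(g1, h1) \<in> S" "h1 < C" for x g1 h1
  proof -
    have "v \<le> g1" using v 1 by force
    consider "x = 0" | g2 h2 where "x = (v - g2) / (h2 - C)" "(g2, h2) \<in> S" "h2 > C"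
      using \<open>x \<in> A\<close> by (auto simp: A_def)
    then show ?thesis
    proof cases
      case 1
      then show ?thesis using \<open>v \<le> g1\<close> \<open>h1 < C\<close> by simp
    next
      case 2
      \<comment> \<open>The weights with which the segment between the two points meets the line
        \<open>h = C\<close>; there the first coordinate is at least \<open>v\<close>.\<close>
      define s where "s = (h2 - C) / (h2 - h1)"
      define r where "r = (C - h1) / (h2 - h1)"
      have sr: "s \<ge> 0" "r \<ge> 0" "s + r = 1"
        using 2 \<open>h1 < C\<close> by (auto simp: s_def r_def add_divide_distrib[symmetric])
      have "s *\<^sub>R (g1, h1) + r *\<^sub>R (g2, h2) \<in> S"
        using convexD[OF S \<open>(g1, h1) \<in> S\<close> 2(2) sr] .
      moreover have "s * h1 + r * h2 = C"
        using 1 2 \<open>h1 < C\<close> unfolding s_def r_def times_divide_eq_left add_divide_distrib[symmetric]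
        by (subst nonzero_divide_eq_eq) (auto simp: algebra_simps)
      ultimately have "v \<le> s * g1 + r * g2" using v[of "s * g1 + r * g2" C] by simp
      then have "(h2 - h1) * v \<le> (h2 - C) * g1 + (C - h1) * g2"
        using 1 2 by (simp add: s_def r_def divide_simps mult.commute)
      then have "(v - g2) * (C - h1) \<le> (g1 - v) * (h2 - C)" by (simp add: algebra_simps)
      then show ?thesis
        using \<open>h1 < C\<close> \<open>h2 > C\<close> unfolding 2(1) by (simp add: pos_divide_le_eq pos_le_divide_eq)
    qed
  qed
  \<comment> \<open>The Slater point supplies a finite upper bound, so that \<open>Sup A\<close> is
    a genuine supremum.\<close>
  have bdd: "bdd_above A" using ub[OF _ slater] by (rule bdd_aboveI)
  have "0 \<in> A" by (simp add: A_def)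
  show ?thesis
  proof (intro exI[of _ \<mu>] conjI allI impI)
    show "\<mu> \<ge> 0" unfolding \<mu>_def using \<open>0 \<in> A\<close> bdd by (rule cSup_upper)
    fix g h assume gh: "(g, h) \<in> S"
    consider "h < C" | "h = C" | "h > C" by linarith
    then show "v \<le> g + \<mu> * (h - C)"
    proof cases
      case 1
      have "\<mu> \<le> (g - v) / (C - h)"
        unfolding \<mu>_def using \<open>0 \<in> A\<close> ub[OF _ gh 1] by (intro cSup_least) auto
      then show ?thesis using 1 by (simp add: divide_simps algebra_simps)
    next
      case 3
      then have "(v - g) / (h - C) \<le> \<mu>"
        unfolding \<mu>_def using gh bdd by (intro cSup_upper) (auto simp: A_def)
      then show ?thesis using 3 by (simp add: divide_simps algebra_simps)
    qed (use v gh in auto)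
  qed
qed

subsection \<open>The penalised problem\<close>

text \<open>\<open>X\<close> abstracts the weight \<open>1 / r\<close>; its integrability is a
  hypothesis of individual lemmas.\<close>

locale tsallis_cost = prob_space M for M :: "real measure" +
  fixes X :: "real \<Rightarrow> real" and q :: real
  assumes X_meas [measurable]: "X \<in> borel_measurable M"
    and X_pos: "r \<in> space M \<Longrightarrow> X r > 0"
    and q_ge_1: "q \<ge> 1"
begin

definition cost :: "(real \<Rightarrow> real) \<Rightarrow> ennreal" where
  "cost \<phi> = (\<integral>\<^sup>+ r. ennreal (\<phi> r powr q * X r) \<partial>M)"

definition gap :: "(real \<Rightarrow> real) \<Rightarrow> ennreal" where
  "gap \<phi> = (\<integral>\<^sup>+ r. ennreal (tsallis_gap q (\<phi> r)) \<partial>M)"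

text \<open>The partition function, that is, the normalising constant of the Gibbs density.\<close>

definition Z :: "real \<Rightarrow> real" where
  "Z l = (\<integral> r. qexp q (- (l * X r)) \<partial>M)"

definition dual :: "real \<Rightarrow> real" where
  "dual l = - qln q (Z l)"

lemma pos_densitiesD:
  assumes "\<phi> \<in> pos_densities M"
  shows "\<phi> \<in> borel_measurable M" "r \<in> space M \<Longrightarrow> 0 < \<phi> r" "(\<integral>\<^sup>+ r. ennreal (\<phi> r) \<partial>M) = 1"
  using assms by (auto simp: pos_densities_def)

lemma const_1_density: "(\<lambda>_. 1) \<in> pos_densities M"
  by (simp add: pos_densities_def emeasure_space_1)

lemma gap_const_1: "gap (\<lambda>_. 1) = 0"
  by (simp add: gap_def)

lemma tsallis_gap_measurable [measurable]: "tsallis_gap q \<in> borel_measurable borel"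
  unfolding tsallis_gap_def [abs_def] by simp

lemma qexp_measurable [measurable]: "qexp q \<in> borel_measurable borel"
  unfolding qexp_def [abs_def] by simp

text \<open>The integrands differ by a multiple of \<open>t - 1\<close>, whose integral over a
  density vanishes. Negative terms are moved to the other side of the equation, so that only
  nonnegative functions are integrated.\<close>

lemma tsallis_div_eq_gap:
  assumes \<phi>: "\<phi> \<in> pos_densities M"
  shows "tsallis_div M q \<phi> = enn2ereal (gap \<phi>)"
proof (cases "q = 1")
  case True
  note [measurable] = pos_densitiesD(1)[OF \<phi>] and pos = pos_densitiesD(2)[OF \<phi>]
  define P where "P = (\<integral>\<^sup>+ r. ennreal (\<phi> r * ln (\<phi> r)) \<partial>M)"
  define N where "N = (\<integral>\<^sup>+ r. ennreal (- (\<phi> r * ln (\<phi> r))) \<partial>M)"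
  \<comment> \<open>Finiteness of \<open>N\<close> makes \<open>P - N\<close> meaningful even for
    infinite \<open>P\<close>.\<close>
  have "N \<le> (\<integral>\<^sup>+ r. 1 \<partial>M)"
    unfolding N_def
  proof (rule nn_integral_mono)
    fix r assume "r \<in> space M"
    then show "ennreal (- (\<phi> r * ln (\<phi> r))) \<le> 1"
      using pos[of r] xlnx_ge_tangent[of "\<phi> r" 1] by simp
  qed
  then have N: "N \<le> 1" by (simp add: emeasure_space_1)
  have "P + 1 = (\<integral>\<^sup>+ r. ennreal (\<phi> r * ln (\<phi> r)) + 1 \<partial>M)"
    unfolding P_def by (subst nn_integral_add) (auto simp: emeasure_space_1)
  also have "\<dots> = (\<integral>\<^sup>+ r. ennreal (tsallis_gap q (\<phi> r)) + (ennreal (- (\<phi> r * ln (\<phi> r))) + ennreal (\<phi> r)) \<partial>M)"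
  proof (rule nn_integral_cong)
    fix r assume "r \<in> space M"
    then have *: "\<phi> r > 0" using pos by blast
    then have "tsallis_gap q (\<phi> r) \<ge> 0" using q_ge_1 by (rule tsallis_gap_nonneg[rotated])
    moreover have "tsallis_gap q (\<phi> r) + \<phi> r = \<phi> r * ln (\<phi> r) + 1"
      using True by (simp add: tsallis_gap_def)
    ultimately show "ennreal (\<phi> r * ln (\<phi> r)) + 1 =
        ennreal (tsallis_gap q (\<phi> r)) + (ennreal (- (\<phi> r * ln (\<phi> r))) + ennreal (\<phi> r))"
    proof (cases "\<phi> r * ln (\<phi> r) \<ge> 0")
      case False
      then have "0 \<le> \<phi> r - \<phi> r * ln (\<phi> r)" using * by linarith
      with False * \<open>tsallis_gap q (\<phi> r) \<ge> 0\<close> \<open>tsallis_gap q (\<phi> r) + \<phi> r = \<phi> r * ln (\<phi> r) + 1\<close>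
      show ?thesis by (simp add: ennreal_neg flip: ennreal_plus ennreal_1)
    qed (use * in \<open>simp add: ennreal_neg flip: ennreal_plus ennreal_1\<close>)
  qed
  also have "\<dots> = gap \<phi> + (N + 1)"
    unfolding N_def gap_def
    by (simp add: nn_integral_add pos_densitiesD(3)[OF \<phi>])
  finally have "1 + P = 1 + (gap \<phi> + N)"
    by (simp add: ac_simps)
  then have "P = gap \<phi> + N"
    by (subst (asm) ennreal_add_left_cancel) simp
  then show ?thesis
    using N True unfolding tsallis_div_def P_def[symmetric] N_def[symmetric]
    by (cases N; cases "gap \<phi>") (auto simp: top_unique simp flip: ennreal_plus)
next
  case False
  with q_ge_1 have q: "q > 1" by simp
  note [measurable] = pos_densitiesD(1)[OF \<phi>] and pos = pos_densitiesD(2)[OF \<phi>]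
  define P where "P = (\<integral>\<^sup>+ r. ennreal (\<phi> r powr q) \<partial>M)"
  have "P + ennreal (q - 1) = (\<integral>\<^sup>+ r. ennreal (\<phi> r powr q) + ennreal (q - 1) \<partial>M)"
    unfolding P_def by (subst nn_integral_add) (auto simp: emeasure_space_1)
  also have "\<dots> = (\<integral>\<^sup>+ r. ennreal (q - 1) * ennreal (tsallis_gap q (\<phi> r)) + ennreal q * ennreal (\<phi> r) \<partial>M)"
  proof (rule nn_integral_cong)
    fix r assume "r \<in> space M"
    then have *: "\<phi> r > 0" using pos by blast
    then have "tsallis_gap q (\<phi> r) \<ge> 0" using q_ge_1 by (rule tsallis_gap_nonneg[rotated])
    moreover have "\<phi> r powr q + (q - 1) = (q - 1) * tsallis_gap q (\<phi> r) + q * \<phi> r"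
    proof -
      have "(q - 1) * tsallis_gap q (\<phi> r) = \<phi> r powr q - 1 - q * (\<phi> r - 1)"
        using q by (simp add: tsallis_gap_def)
      then show ?thesis by (simp add: algebra_simps)
    qed
    ultimately show "ennreal (\<phi> r powr q) + ennreal (q - 1) =
        ennreal (q - 1) * ennreal (tsallis_gap q (\<phi> r)) + ennreal q * ennreal (\<phi> r)"
      using * q by (simp flip: ennreal_plus ennreal_mult')
  qed
  also have "\<dots> = ennreal (q - 1) * gap \<phi> + ennreal q"
    unfolding gap_def
    by (simp add: nn_integral_add nn_integral_cmult pos_densitiesD(3)[OF \<phi>])
  finally have eq: "P + ennreal (q - 1) = ennreal (q - 1) * gap \<phi> + ennreal q" .
  show ?thesis
  proof (cases "gap \<phi>")
    case top
    then have "P = top" using eq q by (simp add: ennreal_mult_eq_top_iff)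
    \<comment> \<open>\<open>1 - P\<close> is minus infinity and \<open>1 / (1 - q)\<close> is
      negative, so the divergence is plus infinity too.\<close>
    then show ?thesis
      using top q False unfolding tsallis_div_def P_def[symmetric] by (simp add: one_ereal_def)
  next
    case (real g)
    with eq q have "P \<noteq> top" by (auto simp flip: ennreal_plus ennreal_mult')
    then obtain p where p: "P = ennreal p" "p \<ge> 0" by (cases P) auto
    have "p + (q - 1) = (q - 1) * g + q"
      using eq q real p by (simp flip: ennreal_plus ennreal_mult')
    then have "1 / (1 - q) * (1 - p) = g" using q by (simp add: field_simps)
    then show ?thesis
      using real p False unfolding tsallis_div_def P_def[symmetric] by (simp add: one_ereal_def)
  qed
qed

section \<open>The partition function and the Gibbs density\<close>

lemma qexp_bounds:
  assumes "l \<ge> 0" "r \<in> space M"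
  shows "0 < qexp q (- (l * X r))" "qexp q (- (l * X r)) \<le> 1"
  using assms X_pos[of r] q_ge_1 by (auto intro!: qexp_gt_0 qexp_le_1)

lemma qexp_integrable:
  assumes "l \<ge> 0"
  shows "integrable M (\<lambda>r. qexp q (- (l * X r)))"
  by (rule integrable_const_bound[where B = 1])
     (use qexp_bounds[OF assms] in \<open>auto simp: abs_of_pos\<close>)

lemma nn_integral_qexp:
  assumes "l \<ge> 0"
  shows "(\<integral>\<^sup>+ r. ennreal (qexp q (- (l * X r))) \<partial>M) = ennreal (Z l)"
  unfolding Z_def using qexp_integrable[OF assms] qexp_bounds[OF assms]
  by (intro nn_integral_eq_integral) (auto simp: less_imp_le)

lemma Z_pos:
  assumes "l \<ge> 0"
  shows "Z l > 0"
proof (rule ccontr)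
  assume "\<not> Z l > 0"
  then have "(\<integral>\<^sup>+ r. ennreal (qexp q (- (l * X r))) \<partial>M) = 0"
    using nn_integral_qexp[OF assms] by (simp add: ennreal_neg)
  then have "AE r in M. ennreal (qexp q (- (l * X r))) = 0"
    by (subst (asm) nn_integral_0_iff_AE) auto
  then have "AE r in M. False"
    by (rule AE_mp) (use qexp_bounds[OF assms] in \<open>auto intro!: AE_I2 simp: ennreal_eq_0_iff not_le\<close>)
  then show False by simp
qed

lemma Z_le_1: "l \<ge> 0 \<Longrightarrow> Z l \<le> 1"
  unfolding Z_def using qexp_integrable qexp_bounds
  by (intro integral_le_const) auto

text \<open>\<open>Z l \<le> 1\<close> gives \<open>qln q (Z l) \<le> 0\<close>. The sign lets
  \<open>dual l\<close> be embedded in \<open>ennreal\<close> without truncation.\<close>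

lemma dual_nonneg: "l \<ge> 0 \<Longrightarrow> dual l \<ge> 0"
  using qln_le_minus_one[OF q_ge_1 Z_pos, of l] Z_le_1[of l] by (simp add: dual_def)

lemma penalised_cost_eq:
  assumes \<phi>: "\<phi> \<in> pos_densities M" and l: "l \<ge> 0"
  shows "ennreal l * cost \<phi> + gap \<phi> =
         (\<integral>\<^sup>+ r. ennreal (l * X r * \<phi> r powr q + tsallis_gap q (\<phi> r)) \<partial>M)"
proof -
  note [measurable] = pos_densitiesD(1)[OF \<phi>]
  have "ennreal l * cost \<phi> + gap \<phi> =
      (\<integral>\<^sup>+ r. ennreal l * ennreal (\<phi> r powr q * X r) + ennreal (tsallis_gap q (\<phi> r)) \<partial>M)"
    unfolding cost_def gap_def by (simp add: nn_integral_add nn_integral_cmult)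
  also have "\<dots> = (\<integral>\<^sup>+ r. ennreal (l * X r * \<phi> r powr q + tsallis_gap q (\<phi> r)) \<partial>M)"
  proof (rule nn_integral_cong)
    fix r assume r: "r \<in> space M"
    have "tsallis_gap q (\<phi> r) \<ge> 0"
      using q_ge_1 pos_densitiesD(2)[OF \<phi> r] by (rule tsallis_gap_nonneg)
    then show "ennreal l * ennreal (\<phi> r powr q * X r) + ennreal (tsallis_gap q (\<phi> r)) =
        ennreal (l * X r * \<phi> r powr q + tsallis_gap q (\<phi> r))"
      using l X_pos[OF r] by (simp add: mult_ac flip: ennreal_plus ennreal_mult')
  qed
  finally show ?thesis .
qed

text \<open>At each \<open>r\<close> this is the tangency point \<open>p\<close> of
  \<open>tsallis_young\<close> for \<open>c = l * X r\<close> and \<open>z = Z l\<close>.\<close>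

definition gibbs :: "real \<Rightarrow> real \<Rightarrow> real" where
  "gibbs l r = qexp q (- (l * X r)) / Z l"

lemma gibbs_density:
  assumes l: "l \<ge> 0"
  shows "gibbs l \<in> pos_densities M"
proof -
  have "(\<integral>\<^sup>+ r. ennreal (gibbs l r) \<partial>M) =
      (\<integral>\<^sup>+ r. ennreal (1 / Z l) * ennreal (qexp q (- (l * X r))) \<partial>M)"
    using Z_pos[OF l] by (intro nn_integral_cong) (simp add: gibbs_def flip: ennreal_mult')
  also have "\<dots> = ennreal (1 / Z l) * ennreal (Z l)"
    by (simp add: nn_integral_cmult nn_integral_qexp[OF l])
  also have "\<dots> = 1"
    using Z_pos[OF l] by (simp flip: ennreal_mult')
  moreover have "gibbs l \<in> borel_measurable M" unfolding gibbs_def [abs_def] by measurable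
  ultimately show ?thesis
    using Z_pos[OF l] qexp_bounds[OF l] by (auto simp: pos_densities_def gibbs_def)
qed

text \<open>The bound \<open>tsallis_young\<close> is shifted by a multiple of the Gibbs density: then both sides are
  nonnegative, so that they can be integrated in \<^typ>\<open>ennreal\<close>.\<close>

lemma
  assumes l: "l \<ge> 0"
  shows dual_le_penalised_cost:
      "\<phi> \<in> pos_densities M \<Longrightarrow> ennreal (dual l) \<le> ennreal l * cost \<phi> + gap \<phi>"
    and penalised_cost_gibbs: "ennreal l * cost (gibbs l) + gap (gibbs l) = ennreal (dual l)"
proof -
  define D where "D = dual l"
  have D: "D \<ge> 0" using dual_nonneg[OF l] by (simp add: D_def)
  \<comment> \<open>The tangent bound reads \<open>1 + D * q * t - A * p\<close>; adding
    \<open>A\<close> times the Gibbs density to both sides removes the negative term.\<close>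
  define A where "A = 1 + D * (q - 1)"
  have A: "A \<ge> 0" using D q_ge_1 by (simp add: A_def)
  \<comment> \<open>The value is the same for all densities: the tangent is affine in the density
    with constant slope \<open>D * q\<close>, so only the total mass 1 enters.\<close>
  have tangent: "(\<integral>\<^sup>+ r. ennreal (1 + D * q * \<psi> r) \<partial>M) = ennreal A + ennreal D"
    if \<psi>: "\<psi> \<in> pos_densities M" for \<psi>
  proof -
    note [measurable] = pos_densitiesD(1)[OF \<psi>]
    have "(\<integral>\<^sup>+ r. ennreal (1 + D * q * \<psi> r) \<partial>M) = (\<integral>\<^sup>+ r. 1 + ennreal (D * q) * ennreal (\<psi> r) \<partial>M)"
      using D q_ge_1 pos_densitiesD(2)[OF \<psi>]
      by (intro nn_integral_cong) (simp add: less_imp_le flip: ennreal_mult')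
    also have "\<dots> = 1 + ennreal (D * q)"
      by (simp add: nn_integral_add nn_integral_cmult pos_densitiesD(3)[OF \<psi>] emeasure_space_1)
    also have "\<dots> = ennreal A + ennreal D"
      using A D q_ge_1 by (simp add: A_def algebra_simps flip: ennreal_plus ennreal_1)
    finally show ?thesis .
  qed
  have shifted: "(\<integral>\<^sup>+ r. ennreal (l * X r * \<psi> r powr q + tsallis_gap q (\<psi> r) + A * gibbs l r) \<partial>M)
      = (ennreal l * cost \<psi> + gap \<psi>) + ennreal A" if \<psi>: "\<psi> \<in> pos_densities M" for \<psi>
  proof -
    note [measurable] = pos_densitiesD(1)[OF \<psi>] pos_densitiesD(1)[OF gibbs_density[OF l]]
    have "(\<integral>\<^sup>+ r. ennreal (l * X r * \<psi> r powr q + tsallis_gap q (\<psi> r) + A * gibbs l r) \<partial>M) =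
      (\<integral>\<^sup>+ r. ennreal (l * X r * \<psi> r powr q + tsallis_gap q (\<psi> r)) + ennreal A * ennreal (gibbs l r) \<partial>M)"
    proof (rule nn_integral_cong)
      fix r assume r: "r \<in> space M"
      have "tsallis_gap q (\<psi> r) \<ge> 0"
        using q_ge_1 pos_densitiesD(2)[OF \<psi> r] by (rule tsallis_gap_nonneg)
      then show "ennreal (l * X r * \<psi> r powr q + tsallis_gap q (\<psi> r) + A * gibbs l r) =
          ennreal (l * X r * \<psi> r powr q + tsallis_gap q (\<psi> r)) + ennreal A * ennreal (gibbs l r)"
        using l X_pos[OF r] A pos_densitiesD(2)[OF gibbs_density[OF l] r]
        by (simp add: less_imp_le flip: ennreal_mult')
    qed
    also have "\<dots> = (ennreal l * cost \<psi> + gap \<psi>) + ennreal A"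
      by (simp add: nn_integral_add nn_integral_cmult pos_densitiesD(3)[OF gibbs_density[OF l]]
            penalised_cost_eq[OF \<psi> l])
    finally show ?thesis .
  qed
  have X0: "l * X r \<ge> 0" if "r \<in> space M" for r using l X_pos[OF that] by simp
  show "ennreal (dual l) \<le> ennreal l * cost \<phi> + gap \<phi>" if \<phi>: "\<phi> \<in> pos_densities M"
  proof -
    have "ennreal A + ennreal D \<le> (ennreal l * cost \<phi> + gap \<phi>) + ennreal A"
      unfolding tangent[OF \<phi>, symmetric] shifted[OF \<phi>, symmetric]
    proof (intro nn_integral_mono ennreal_leI)
      fix r assume r: "r \<in> space M"
      show "1 + D * q * \<phi> r \<le> l * X r * \<phi> r powr q + tsallis_gap q (\<phi> r) + A * gibbs l r"
        using tsallis_young(1)[OF q_ge_1 X0[OF r] Z_pos[OF l] pos_densitiesD(2)[OF \<phi> r]]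
        unfolding gibbs_def[symmetric] dual_def[symmetric] D_def[symmetric]
        by (simp add: A_def algebra_simps)
    qed
    then show ?thesis
      by (simp add: D_def add.commute)
  qed
  have "ennreal A + ennreal D = (ennreal l * cost (gibbs l) + gap (gibbs l)) + ennreal A"
    unfolding tangent[OF gibbs_density[OF l], symmetric] shifted[OF gibbs_density[OF l], symmetric]
  proof (intro nn_integral_cong arg_cong[where f = ennreal])
    fix r assume r: "r \<in> space M"
    show "1 + D * q * gibbs l r =
        l * X r * gibbs l r powr q + tsallis_gap q (gibbs l r) + A * gibbs l r"
      \<comment> \<open>Equality holds at the tangency point itself; \<open>zero_less_one\<close>
        instantiates the auxiliary \<open>t\<close> with 1.\<close>
      using tsallis_young(2)[OF q_ge_1 X0[OF r] Z_pos[OF l] zero_less_one]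
      unfolding gibbs_def[symmetric] dual_def[symmetric] D_def[symmetric]
      by (simp add: A_def algebra_simps)
  qed
  then show "ennreal l * cost (gibbs l) + gap (gibbs l) = ennreal (dual l)"
    by (simp add: D_def add.commute)
qed

lemma enn2ereal_penalised_cost:
  "l \<ge> 0 \<Longrightarrow> ereal l * enn2ereal (cost \<phi>) + enn2ereal (gap \<phi>) = enn2ereal (ennreal l * cost \<phi> + gap \<phi>)"
  by (simp add: plus_ennreal.rep_eq times_ennreal.rep_eq)

text \<open>\<open>dual l\<close> is a lower bound and the Gibbs density attains it. This is the
  first identity of the theorem for a general weight.\<close>

lemma dual_eq_INF:
  assumes l: "l \<ge> 0"
  shows "ereal (dual l) =
    (INF \<phi>\<in>pos_densities M. ereal l * enn2ereal (cost \<phi>) + tsallis_div M q \<phi>)"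
proof -
  have eq: "ereal l * enn2ereal (cost \<phi>) + tsallis_div M q \<phi> = enn2ereal (ennreal l * cost \<phi> + gap \<phi>)"
    if "\<phi> \<in> pos_densities M" for \<phi>
    using that l by (simp add: tsallis_div_eq_gap enn2ereal_penalised_cost)
  have D: "ereal (dual l) = enn2ereal (ennreal (dual l))" using dual_nonneg[OF l] by simp
  show ?thesis
  proof (rule antisym)
    show "ereal (dual l) \<le> (INF \<phi>\<in>pos_densities M. ereal l * enn2ereal (cost \<phi>) + tsallis_div M q \<phi>)"
      using dual_le_penalised_cost[OF l]
      by (intro INF_greatest) (simp add: eq D less_eq_ennreal.rep_eq)
    have "(INF \<phi>\<in>pos_densities M. ereal l * enn2ereal (cost \<phi>) + tsallis_div M q \<phi>)
        \<le> ereal l * enn2ereal (cost (gibbs l)) + tsallis_div M q (gibbs l)"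
      by (rule INF_lower) (rule gibbs_density[OF l])
    also have "\<dots> = ereal (dual l)"
      unfolding eq[OF gibbs_density[OF l]] penalised_cost_gibbs[OF l] D ..
    finally show "(INF \<phi>\<in>pos_densities M. ereal l * enn2ereal (cost \<phi>) + tsallis_div M q \<phi>) \<le> ereal (dual l)" .
  qed
qed

subsection \<open>Duality for the constrained problem\<close>

lemma pos_densities_convex_combination:
  assumes \<phi>: "\<phi> \<in> pos_densities M" and \<psi>: "\<psi> \<in> pos_densities M"
    and uv: "u \<ge> 0" "v \<ge> 0" "u + v = 1"
  shows "(\<lambda>r. u * \<phi> r + v * \<psi> r) \<in> pos_densities M"
proof -
  note [measurable] = pos_densitiesD(1)[OF \<phi>] pos_densitiesD(1)[OF \<psi>]
  have pos: "u * \<phi> r + v * \<psi> r > 0" if "r \<in> space M" for r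
    using convexD[of "{0<..}" "\<phi> r" "\<psi> r" u v] uv pos_densitiesD(2)[OF \<phi> that] pos_densitiesD(2)[OF \<psi> that]
    by simp
  have "(\<integral>\<^sup>+ r. ennreal (u * \<phi> r + v * \<psi> r) \<partial>M) =
      (\<integral>\<^sup>+ r. ennreal u * ennreal (\<phi> r) + ennreal v * ennreal (\<psi> r) \<partial>M)"
    using uv pos_densitiesD(2)[OF \<phi>] pos_densitiesD(2)[OF \<psi>]
    by (intro nn_integral_cong) (simp add: less_imp_le flip: ennreal_plus ennreal_mult')
  also have "\<dots> = 1"
    using uv by (simp add: nn_integral_add nn_integral_cmult pos_densitiesD(3)[OF \<phi>]
        pos_densitiesD(3)[OF \<psi>] flip: ennreal_plus)
  finally show ?thesis using pos by (simp add: pos_densities_def)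
qed

text \<open>Convexity of \<open>f\<close> applied pointwise. The weight \<open>w\<close> lets one
  lemma serve both the cost (\<open>w = X\<close>) and the gap (\<open>w = 1\<close>).\<close>

lemma nn_integral_convex_combination_le:
  assumes \<phi>: "\<phi> \<in> pos_densities M" and \<psi>: "\<psi> \<in> pos_densities M"
    and uv: "u \<ge> 0" "v \<ge> 0" "u + v = 1"
    and f: "convex_on {0<..} f" "\<And>t. t > 0 \<Longrightarrow> f t \<ge> 0" and [measurable]: "f \<in> borel_measurable borel"
    and w: "\<And>r. r \<in> space M \<Longrightarrow> w r \<ge> 0" and [measurable]: "w \<in> borel_measurable M"
  shows "(\<integral>\<^sup>+ r. ennreal (f (u * \<phi> r + v * \<psi> r) * w r) \<partial>M) \<le>
    ennreal u * (\<integral>\<^sup>+ r. ennreal (f (\<phi> r) * w r) \<partial>M) + ennreal v * (\<integral>\<^sup>+ r. ennreal (f (\<psi> r) * w r) \<partial>M)"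
proof -
  note [measurable] = pos_densitiesD(1)[OF \<phi>] pos_densitiesD(1)[OF \<psi>]
  have "(\<integral>\<^sup>+ r. ennreal (f (u * \<phi> r + v * \<psi> r) * w r) \<partial>M) \<le>
    (\<integral>\<^sup>+ r. ennreal u * ennreal (f (\<phi> r) * w r) + ennreal v * ennreal (f (\<psi> r) * w r) \<partial>M)"
  proof (rule nn_integral_mono)
    fix r assume r: "r \<in> space M"
    have pos: "\<phi> r > 0" "\<psi> r > 0" using pos_densitiesD(2) \<phi> \<psi> r by auto
    have "f (u * \<phi> r + v * \<psi> r) \<le> u * f (\<phi> r) + v * f (\<psi> r)"
      using f(1) uv pos by (auto simp: convex_on_def)
    then have "f (u * \<phi> r + v * \<psi> r) * w r \<le> (u * f (\<phi> r) + v * f (\<psi> r)) * w r"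
      using w[OF r] by (rule mult_right_mono)
    also have "\<dots> = u * (f (\<phi> r) * w r) + v * (f (\<psi> r) * w r)" by (simp add: algebra_simps)
    finally have "ennreal (f (u * \<phi> r + v * \<psi> r) * w r) \<le> ennreal (u * (f (\<phi> r) * w r) + v * (f (\<psi> r) * w r))"
      by (rule ennreal_leI)
    also have "\<dots> = ennreal u * ennreal (f (\<phi> r) * w r) + ennreal v * ennreal (f (\<psi> r) * w r)"
      using uv f(2) pos w[OF r] by (simp flip: ennreal_plus ennreal_mult')
    finally show "ennreal (f (u * \<phi> r + v * \<psi> r) * w r) \<le>
      ennreal u * ennreal (f (\<phi> r) * w r) + ennreal v * ennreal (f (\<psi> r) * w r)" .
  qed
  also have "\<dots> = ennreal u * (\<integral>\<^sup>+ r. ennreal (f (\<phi> r) * w r) \<partial>M) + ennreal v * (\<integral>\<^sup>+ r. ennreal (f (\<psi> r) * w r) \<partial>M)"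
    by (simp add: nn_integral_add nn_integral_cmult)
  finally show ?thesis .
qed

text \<open>The pairs of cost and gap, closed upwards. Both functionals are convex rather than
  affine in the density, so the inequalities are what makes this set convex; the real bounds leave
  out infinite values.\<close>

definition attainable :: "(real \<times> real) set" where
  "attainable = {(g, h). g \<ge> 0 \<and> h \<ge> 0 \<and>
     (\<exists>\<phi>\<in>pos_densities M. cost \<phi> \<le> ennreal g \<and> gap \<phi> \<le> ennreal h)}"

lemma convex_attainable: "convex attainable"
proof (rule convexI)
  fix x y :: "real \<times> real" and u v :: real
  assume x: "x \<in> attainable" and y: "y \<in> attainable" and uv: "0 \<le> u" "0 \<le> v" "u + v = 1"
  obtain g1 h1 \<phi> where 1: "x = (g1, h1)" "g1 \<ge> 0" "h1 \<ge> 0" "\<phi> \<in> pos_densities M"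
    "cost \<phi> \<le> ennreal g1" "gap \<phi> \<le> ennreal h1"
    using x by (auto simp: attainable_def)
  obtain g2 h2 \<psi> where 2: "y = (g2, h2)" "g2 \<ge> 0" "h2 \<ge> 0" "\<psi> \<in> pos_densities M"
    "cost \<psi> \<le> ennreal g2" "gap \<psi> \<le> ennreal h2"
    using y by (auto simp: attainable_def)
  define \<xi> where "\<xi> = (\<lambda>r. u * \<phi> r + v * \<psi> r)"
  have "cost \<xi> \<le> ennreal u * cost \<phi> + ennreal v * cost \<psi>"
    unfolding cost_def \<xi>_def using X_pos
    by (intro nn_integral_convex_combination_le 1 2 uv powr_convex q_ge_1) (auto simp: less_imp_le)
  also have "\<dots> \<le> ennreal u * ennreal g1 + ennreal v * ennreal g2"
    by (intro add_mono mult_left_mono 1 2) auto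
  also have "\<dots> = ennreal (u * g1 + v * g2)"
    using 1 2 uv by (simp flip: ennreal_plus ennreal_mult')
  finally have cost: "cost \<xi> \<le> ennreal (u * g1 + v * g2)" .
  have "gap \<xi> \<le> ennreal u * gap \<phi> + ennreal v * gap \<psi>"
    unfolding gap_def \<xi>_def
    using nn_integral_convex_combination_le[OF 1(4) 2(4) uv convex_on_tsallis_gap[OF q_ge_1]
        tsallis_gap_nonneg[OF q_ge_1], of "\<lambda>_. 1"]
    by simp
  also have "\<dots> \<le> ennreal u * ennreal h1 + ennreal v * ennreal h2"
    by (intro add_mono mult_left_mono 1 2) auto
  also have "\<dots> = ennreal (u * h1 + v * h2)"
    using 1 2 uv by (simp flip: ennreal_plus ennreal_mult')
  finally have "gap \<xi> \<le> ennreal (u * h1 + v * h2)" .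
  then show "u *\<^sub>R x + v *\<^sub>R y \<in> attainable"
    using cost pos_densities_convex_combination[OF 1(4) 2(4) uv] 1 2 uv
    by (auto simp: attainable_def \<xi>_def)
qed

text \<open>The bound \<open>dual l \<le> l * cost \<phi> + gap \<phi>\<close>, with the gap
  replaced by \<open>C\<close>, is solved for the cost.\<close>

lemma weak_duality:
  assumes "l > 0" "C \<ge> 0" and \<phi>: "\<phi> \<in> pos_densities M" "gap \<phi> \<le> ennreal C"
  shows "ereal ((dual l - C) / l) \<le> enn2ereal (cost \<phi>)"
proof (cases "cost \<phi>")
  case (real c)
  have "ennreal (dual l) \<le> ennreal l * cost \<phi> + gap \<phi>"
    using assms by (intro dual_le_penalised_cost) auto
  also have "\<dots> \<le> ennreal l * ennreal c + ennreal C"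
    unfolding real by (intro add_left_mono \<phi>)
  also have "\<dots> = ennreal (l * c + C)"
    using assms real by (simp flip: ennreal_plus ennreal_mult')
  finally have "dual l \<le> l * c + C"
    using assms real by (subst (asm) ennreal_le_iff) auto
  then show ?thesis
    using assms real by (simp add: pos_divide_le_eq algebra_simps)
qed simp

text \<open>The penalised cost of the Gibbs density is finite, so for \<open>l > 0\<close> its cost
  and its gap are both finite and form a point of the set.\<close>

lemma gibbs_attainable:
  assumes l: "l > 0"
  obtains g h where "(g, h) \<in> attainable" "dual l = l * g + h"
proof -
  have eq: "ennreal l * cost (gibbs l) + gap (gibbs l) = ennreal (dual l)"
    using l by (intro penalised_cost_gibbs) auto
  then have "cost (gibbs l) \<noteq> top" "gap (gibbs l) \<noteq> top"
    using l by (auto simp: ennreal_mult_eq_top_iff)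
  then obtain g h where gh: "cost (gibbs l) = ennreal g" "g \<ge> 0" "gap (gibbs l) = ennreal h" "h \<ge> 0"
    by (cases "cost (gibbs l)"; cases "gap (gibbs l)") auto
  show thesis
  proof (rule that)
    show "(g, h) \<in> attainable"
      using gh gibbs_density[of l] l by (auto simp: attainable_def intro!: bexI[of _ "gibbs l"])
    show "dual l = l * g + h"
      using eq gh l dual_nonneg[of l] by (simp flip: ennreal_plus ennreal_mult')
  qed
qed

lemma cost_const_1: "integrable M X \<Longrightarrow> cost (\<lambda>_. 1) = ennreal (\<integral> r. X r \<partial>M)"
  unfolding cost_def using X_pos by (simp add: nn_integral_eq_integral less_imp_le)

lemma integral_X_nonneg: "(\<integral> r. X r \<partial>M) \<ge> 0"
  by (rule integral_nonneg_AE) (auto intro!: AE_I2 less_imp_le X_pos)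

text \<open>\<open>dual l / l\<close> is at least the mean of
  \<open>(1 - qexp q (- (l * X r))) / l\<close>, which tends to the mean of \<open>X\<close> as
  \<open>l \<rightarrow> 0\<close>. This settles the case \<open>C = 0\<close>, where no Slater
  point exists.\<close>

lemma integral_cost_le_SUP_dual:
  assumes int: "integrable M X"
  shows "ereal (\<integral> r. X r \<partial>M) \<le> (SUP l\<in>{0<..}. ereal (dual l / l))"
proof (rule Lim_bounded)
  let ?l = "\<lambda>n. 1 / real (Suc n)"
  let ?s = "\<lambda>n r. (1 - qexp q (- (?l n * X r))) / ?l n"
  have "(\<lambda>n. \<integral> r. ?s n r \<partial>M) \<longlonglongrightarrow> (\<integral> r. X r \<partial>M)"
  proof (rule integral_dominated_convergence[where w = X])
    show "AE r in M. (\<lambda>n. ?s n r) \<longlonglongrightarrow> X r"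
    proof (rule AE_I2)
      fix r assume r: "r \<in> space M"
      have "(\<lambda>h. (qexp q (0 + h) - qexp q 0) / h) \<midarrow>0\<rightarrow> 1"
        using qexp_DERIV_0 unfolding DERIV_def .
      moreover have "qexp q 0 = 1" by (simp add: qexp_def)
      ultimately have lim: "((\<lambda>h. (qexp q h - 1) / h) \<longlongrightarrow> 1) (at 0)" by simp
      have "(\<lambda>n. - (?l n * X r)) \<longlonglongrightarrow> - (0 * X r)"
        by (intro tendsto_intros LIMSEQ_Suc[OF lim_1_over_n])
      \<comment> \<open>Positivity of \<open>X r\<close> keeps the arguments different from 0, as
        the limit of the difference quotient requires.\<close>
      then have "filterlim (\<lambda>n. - (?l n * X r)) (at 0) sequentially"
        using X_pos[OF r] by (intro filterlim_atI) auto
      from filterlim_compose[OF lim this]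
      have "(\<lambda>n. X r * ((qexp q (- (?l n * X r)) - 1) / - (?l n * X r))) \<longlonglongrightarrow> X r * 1"
        by (intro tendsto_intros)
      moreover have "X r * ((qexp q (- (?l n * X r)) - 1) / - (?l n * X r)) = ?s n r" for n
        using X_pos[OF r] by (simp add: divide_simps) (simp add: algebra_simps)
      ultimately show "(\<lambda>n. ?s n r) \<longlonglongrightarrow> X r" by simp
    qed
    show "AE r in M. norm (?s n r) \<le> X r" for n
    proof (rule AE_I2)
      fix r assume r: "r \<in> space M"
      have "?l n * X r \<ge> 0" using X_pos[OF r] by simp
      from qexp_ge_add_one[OF q_ge_1 this] qexp_le_1[OF q_ge_1 this]
      have "0 \<le> 1 - qexp q (- (?l n * X r))" "1 - qexp q (- (?l n * X r)) \<le> X r * ?l n" by auto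
      then have "0 \<le> ?s n r" "?s n r \<le> X r"
        by (simp, subst pos_divide_le_eq) auto
      then show "norm (?s n r) \<le> X r" by simp
    qed
  qed (use int in auto)
  then show "(\<lambda>n. ereal (\<integral> r. ?s n r \<partial>M)) \<longlonglongrightarrow> ereal (\<integral> r. X r \<partial>M)" by simp
  show "\<forall>n\<ge>0. ereal (\<integral> r. ?s n r \<partial>M) \<le> (SUP l\<in>{0<..}. ereal (dual l / l))"
  proof (intro allI impI SUP_upper2)
    fix n :: nat
    have l: "?l n > 0" by simp
    have "(\<integral> r. ?s n r \<partial>M) = (1 - Z (?l n)) / ?l n"
      unfolding Z_def using qexp_integrable[of "?l n"] l
      by (subst integral_divide_zero, subst Bochner_Integration.integral_diff) (auto simp: prob_space)
    also have "\<dots> \<le> dual (?l n) / ?l n"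
      unfolding dual_def using qln_le_minus_one[OF q_ge_1 Z_pos, of "?l n"] l
      by (intro divide_right_mono) auto
    finally show "ereal (\<integral> r. ?s n r \<partial>M) \<le> ereal (dual (?l n) / ?l n)" by simp
    show "?l n \<in> {0<..}" using l by simp
  qed
qed

lemma strong_duality:
  assumes int: "integrable M X" and C: "C \<ge> 0"
  shows "(SUP l\<in>{0<..}. ereal ((dual l - C) / l)) =
    (INF \<phi>\<in>{\<phi> \<in> pos_densities M. gap \<phi> \<le> ennreal C}. enn2ereal (cost \<phi>))" (is "?S = ?I")
proof (rule antisym)
  show "?S \<le> ?I"
    using C by (intro SUP_least INF_greatest) (auto intro: weak_duality)
  have I: "?I \<le> ereal (\<integral> r. X r \<partial>M)"
    by (rule INF_lower2[of "\<lambda>_. 1"])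
       (simp_all add: const_1_density gap_const_1 cost_const_1[OF int] integral_X_nonneg)
  show "?I \<le> ?S"
  proof (cases "C = 0")
    case True
    then show ?thesis using I integral_cost_le_SUP_dual[OF int] by simp
  next
    case False
    with C have C: "C > 0" by simp
    \<comment> \<open>The infimum lies between 0 and the finite cost of the density 1, so it is a
      real number.\<close>
    have "0 \<le> ?I" by (intro INF_greatest) simp
    with I obtain v where v: "?I = ereal v" by (cases ?I) auto
    have low: "v \<le> g" if gh: "(g, h) \<in> attainable" "h \<le> C" for g h
    proof -
      obtain \<phi> where \<phi>: "g \<ge> 0" "\<phi> \<in> pos_densities M" "cost \<phi> \<le> ennreal g" "gap \<phi> \<le> ennreal h"
        using gh by (auto simp: attainable_def)
      have "gap \<phi> \<le> ennreal C" using \<phi>(4) gh(2) by (meson ennreal_leI order_trans)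
      then have "ereal v \<le> enn2ereal (cost \<phi>)"
        unfolding v[symmetric] using \<phi> by (intro INF_lower) simp
      also have "\<dots> \<le> enn2ereal (ennreal g)" using \<phi>(3) by (simp add: less_eq_ennreal.rep_eq)
      finally show ?thesis using \<phi>(1) by simp
    qed
    \<comment> \<open>The constant density 1 has gap 0, strictly below \<open>C\<close>.\<close>
    have slater: "((\<integral> r. X r \<partial>M), 0) \<in> attainable"
      unfolding attainable_def using integral_X_nonneg
      by (simp, intro bexI[OF _ const_1_density]) (simp add: gap_const_1 cost_const_1[OF int])
    have "\<exists>\<mu>\<ge>0. \<forall>g h. (g, h) \<in> attainable \<longrightarrow> v \<le> g + \<mu> * (h - C)"
      by (rule convex_lagrange_multiplier[OF convex_attainable _ slater C]) (rule low)
    then obtain \<mu> where \<mu>: "\<mu> \<ge> 0" "\<And>g h. (g, h) \<in> attainable \<Longrightarrow> v \<le> g + \<mu> * (h - C)"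
      by blast
    show ?thesis
    proof (cases "\<mu> = 0")
      case False
      \<comment> \<open>With \<open>l = 1 / \<mu>\<close>, the term
        \<open>g + \<mu> * (h - C)\<close> equals \<open>(l * g + h - C) / l\<close>, which at the
        Gibbs point is the dual quotient.\<close>
      with \<mu> have l: "1 / \<mu> > 0" by simp
      obtain g h where gh: "(g, h) \<in> attainable" "dual (1 / \<mu>) = 1 / \<mu> * g + h"
        by (rule gibbs_attainable[OF l])
      have "v \<le> g + \<mu> * (h - C)" using \<mu>(2)[OF gh(1)] .
      also have "\<dots> = (dual (1 / \<mu>) - C) / (1 / \<mu>)"
        unfolding gh(2) using False by (simp add: algebra_simps)
      finally have "ereal v \<le> ereal ((dual (1 / \<mu>) - C) / (1 / \<mu>))" by simp
      also have "\<dots> \<le> ?S" using l by (intro SUP_upper) simp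
      finally show ?thesis by (simp add: v)
    next
      case True
      show ?thesis
        unfolding v
      proof (rule ereal_le_epsilon2)
        fix \<epsilon> :: real assume \<epsilon>: "\<epsilon> > 0"
        \<comment> \<open>Chosen so that \<open>C / l = \<epsilon>\<close>. With
          \<open>\<mu> = 0\<close>, every attainable point has \<open>v \<le> g\<close>, so
          \<open>(dual l - C) / l\<close> is at least \<open>v - \<epsilon>\<close>.\<close>
        define l where "l = C / \<epsilon>"
        have l: "l > 0" using C \<epsilon> by (simp add: l_def)
        obtain g h where gh: "(g, h) \<in> attainable" "dual l = l * g + h"
          by (rule gibbs_attainable[OF l])
        have "h / l \<ge> 0" using gh(1) l by (simp add: attainable_def)
        moreover have "v \<le> g" using \<mu>(2)[OF gh(1)] True by simp
        moreover have "(dual l - C) / l = g + h / l - C / l"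
          unfolding gh(2) add_divide_distrib diff_divide_distrib using l by simp
        ultimately have "v - C / l \<le> (dual l - C) / l" by simp
        moreover have "C / l = \<epsilon>" using C \<epsilon> by (simp add: l_def)
        ultimately have "ereal v \<le> ereal ((dual l - C) / l) + ereal \<epsilon>" by simp
        also have "\<dots> \<le> ?S + ereal \<epsilon>" using l by (intro add_right_mono SUP_upper) simp
        finally show "ereal v \<le> ?S + ereal \<epsilon>" .
      qed
    qed
  qed
qed

text \<open>By \<open>qln_scale\<close> the terms of the supremum are a positive constant times
  those of \<open>strong_duality\<close>; such a constant commutes with suprema and infima in
  \<open>ereal\<close>.\<close>

lemma lower_TsVaR_eq_INF:
  assumes int: "integrable M X" and a: "0 < a" "a \<le> 1"
  shows "(SUP l\<in>{0<..}. ereal (- (1 / l) * qln q (1 / a * Z l))) =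
    (INF \<phi>\<in>pos_densities_le M q a. ereal (a powr (q - 1)) * enn2ereal (cost \<phi>))"
proof -
  define C where "C = - qln q a"
  define k where "k = a powr (q - 1)"
  have k: "k > 0" using a by (simp add: k_def)
  have C: "C \<ge> 0" using qln_le_minus_one[OF q_ge_1 a(1)] a by (simp add: C_def)
  have le: "pos_densities_le M q a = {\<phi> \<in> pos_densities M. gap \<phi> \<le> ennreal C}"
    using C unfolding pos_densities_le_def C_def[symmetric]
    by (auto simp: tsallis_div_eq_gap less_eq_ennreal.rep_eq)
  have slope: "- (1 / l) * qln q (1 / a * Z l) = k * ((dual l - C) / l)" if "l > 0" for l
  proof -
    have "Z l > 0" using that by (intro Z_pos) simp
    then have "- qln q (1 / a * Z l) = k * (dual l - C)"
      using a qln_scale[of a "Z l" q] by (simp add: k_def dual_def C_def)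
    then show ?thesis by (simp add: divide_simps)
  qed
  have "(SUP l\<in>{0<..}. ereal (- (1 / l) * qln q (1 / a * Z l))) =
      (SUP l\<in>{0<..}. ereal k * ereal ((dual l - C) / l))"
    using slope by (intro SUP_cong) (simp_all only: greaterThan_iff times_ereal.simps)
  also have "\<dots> = ereal k * (SUP l\<in>{0<..}. ereal ((dual l - C) / l))"
    using k by (intro Sup_ereal_mult_left'[symmetric]) auto
  also have "\<dots> = ereal k * (INF \<phi>\<in>pos_densities_le M q a. enn2ereal (cost \<phi>))"
    unfolding strong_duality[OF int C] le ..
  also have "\<dots> = (INF \<phi>\<in>pos_densities_le M q a. ereal k * enn2ereal (cost \<phi>))"
    using ereal_Inf_cmult[OF k, of "\<lambda>x. x \<in> (\<lambda>\<phi>. enn2ereal (cost \<phi>)) ` pos_densities_le M q a"]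
    by (simp add: setcompr_eq_image image_image)
  finally show ?thesis by (simp add: k_def)
qed

end

subsection \<open>The Gamma distribution\<close>

text \<open>Substituting \<open>r = \<beta> * x\<close> gives Euler's integral for
  \<open>Gamma\<close>.\<close>

lemma nn_integral_gamma_kernel:
  fixes s \<beta> :: real
  assumes s: "s > 0" and \<beta>: "\<beta> > 0"
  shows "(\<integral>\<^sup>+ r. ennreal (r powr (s - 1) * exp (- r / \<beta>)) * indicator {0<..} r \<partial>lborel) =
         ennreal (Gamma s * \<beta> powr s)"
proof -
  have "(\<integral>\<^sup>+ r. ennreal (r powr (s - 1) * exp (- r / \<beta>)) * indicator {0<..} r \<partial>lborel) =
      ennreal \<beta> * (\<integral>\<^sup>+ x. ennreal ((\<beta> * x) powr (s - 1) * exp (- (\<beta> * x) / \<beta>)) * indicator {0<..} (\<beta> * x) \<partial>lborel)"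
    using \<beta> by (subst nn_integral_real_affine[where c = \<beta> and t = 0]) auto
  \<comment> \<open>At \<open>x = 0\<close> the two indicators differ, but
    \<open>0 powr (s - 1) = 0\<close>.\<close>
  also have "(\<integral>\<^sup>+ x. ennreal ((\<beta> * x) powr (s - 1) * exp (- (\<beta> * x) / \<beta>)) * indicator {0<..} (\<beta> * x) \<partial>lborel) =
      (\<integral>\<^sup>+ x. ennreal (\<beta> powr (s - 1)) * ennreal (indicator {0..} x * x powr (s - 1) / exp x) \<partial>lborel)"
    using \<beta>
    by (intro nn_integral_cong)
       (auto simp: indicator_def zero_less_mult_iff powr_mult exp_minus field_simps simp flip: ennreal_mult')
  also have "\<dots> = ennreal (\<beta> powr (s - 1)) * ennreal (Gamma s)"
    by (simp add: nn_integral_cmult Gamma_conv_nn_integral_real[OF s])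
  also have "ennreal \<beta> * \<dots> = ennreal (\<beta> * \<beta> powr (s - 1) * Gamma s)"
    using \<beta> s by (simp add: mult.assoc flip: ennreal_mult')
  also have "\<beta> * \<beta> powr (s - 1) * Gamma s = Gamma s * \<beta> powr s"
    using \<beta> by (simp add: powr_mult_base)
  finally show ?thesis .
qed

lemma space_gamma_measure [simp]: "space (gamma_measure \<alpha> \<beta>) = {0<..}"
  by (simp add: gamma_measure_def space_restrict_space)

lemma sets_gamma_measure [measurable_cong]:
  "sets (gamma_measure \<alpha> \<beta>) = sets (restrict_space borel {0<..})"
  by (simp add: gamma_measure_def cong: sets_restrict_space_cong)

text \<open>The moments of the Gamma distribution: \<open>s = 0\<close> gives the total mass 1, and
  \<open>s = - 1\<close> the finite mean of \<open>1 / r\<close> when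
  \<open>\<alpha> > 1\<close>.\<close>

lemma nn_integral_gamma_measure_powr:
  assumes \<alpha>: "\<alpha> > 0" and \<beta>: "\<beta> > 0" and s: "\<alpha> + s > 0"
  shows "(\<integral>\<^sup>+ r. ennreal (r powr s) \<partial>gamma_measure \<alpha> \<beta>) =
         ennreal (Gamma (\<alpha> + s) * \<beta> powr s / Gamma \<alpha>)"
proof -
  define c where "c = 1 / (Gamma \<alpha> * \<beta> powr \<alpha>)"
  have G: "Gamma \<alpha> > 0" "Gamma (\<alpha> + s) > 0" using \<alpha> s by (auto intro: Gamma_real_pos)
  have c: "c > 0" using \<beta> G by (simp add: c_def)
  have "(\<integral>\<^sup>+ r. ennreal (r powr s) \<partial>gamma_measure \<alpha> \<beta>) =
      (\<integral>\<^sup>+ r. ennreal (c * r powr (\<alpha> - 1) * exp (- r / \<beta>)) * ennreal (r powr s) \<partial>restrict_space lborel {0<..})"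
    unfolding gamma_measure_def c_def
    by (subst nn_integral_density) (auto intro!: measurable_restrict_space1)
  also have "\<dots> = (\<integral>\<^sup>+ r. (ennreal (c * r powr (\<alpha> - 1) * exp (- r / \<beta>)) * ennreal (r powr s)) * indicator {0<..} r \<partial>lborel)"
    by (subst nn_integral_restrict_space) auto
  also have "\<dots> = (\<integral>\<^sup>+ r. ennreal c * (ennreal (r powr (\<alpha> + s - 1) * exp (- r / \<beta>)) * indicator {0<..} r) \<partial>lborel)"
    using c
    by (intro nn_integral_cong)
       (auto simp: indicator_def powr_add powr_diff field_simps simp flip: ennreal_mult')
  also have "\<dots> = ennreal (c * (Gamma (\<alpha> + s) * \<beta> powr (\<alpha> + s)))"
    using c nn_integral_gamma_kernel[OF s \<beta>]
    by (subst nn_integral_cmult) (simp_all only: ennreal_mult' less_imp_le, measurable)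
  also have "c * (Gamma (\<alpha> + s) * \<beta> powr (\<alpha> + s)) = Gamma (\<alpha> + s) * \<beta> powr s / Gamma \<alpha>"
    using \<beta> by (simp add: c_def powr_add)
  finally show ?thesis .
qed

lemma prob_space_gamma_measure:
  assumes "\<alpha> > 0" "\<beta> > 0"
  shows "prob_space (gamma_measure \<alpha> \<beta>)"
proof
  have "emeasure (gamma_measure \<alpha> \<beta>) (space (gamma_measure \<alpha> \<beta>)) =
      (\<integral>\<^sup>+ r. ennreal (r powr 0) \<partial>gamma_measure \<alpha> \<beta>)"
    by (subst nn_integral_cong[where v = "\<lambda>_. 1"]) auto
  also have "\<dots> = 1"
    using assms Gamma_real_pos[OF assms(1)]
    by (subst nn_integral_gamma_measure_powr) (simp_all add: less_imp_neq[symmetric])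
  finally show "emeasure (gamma_measure \<alpha> \<beta>) (space (gamma_measure \<alpha> \<beta>)) = 1" .
qed

lemma integrable_gamma_measure_inverse:
  assumes "\<alpha> > 1" "\<beta> > 0"
  shows "integrable (gamma_measure \<alpha> \<beta>) (\<lambda>r. 1 / r)"
proof (rule integrableI_nonneg)
  show "(\<lambda>r. 1 / r) \<in> borel_measurable (gamma_measure \<alpha> \<beta>)"
    by (auto simp: measurable_cong_sets[OF sets_gamma_measure refl] intro!: measurable_restrict_space1)
  have "(\<integral>\<^sup>+ r. ennreal (1 / r) \<partial>gamma_measure \<alpha> \<beta>) = (\<integral>\<^sup>+ r. ennreal (r powr - 1) \<partial>gamma_measure \<alpha> \<beta>)"
    by (intro nn_integral_cong) (simp add: powr_minus_divide)
  also have "\<dots> < \<infinity>"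
    using assms by (subst nn_integral_gamma_measure_powr) auto
  finally show "(\<integral>\<^sup>+ r. ennreal (1 / r) \<partial>gamma_measure \<alpha> \<beta>) < \<infinity>" .
qed (auto intro!: AE_I2)

theorem proposition6:
  fixes \<alpha> \<beta> q :: real and \<pi> :: "real measure"
  assumes "\<alpha> > 1" and "\<beta> > 0" and "q \<ge> 1"
    and "\<pi> = gamma_measure \<alpha> \<beta>"
  shows "(\<forall>l>0.
            ereal (- qln q (\<integral>r. qexp q (- l / r) \<partial>\<pi>)) =
            (INF \<phi>\<in>pos_densities \<pi>.
               ereal l * enn2ereal (\<integral>\<^sup>+ r. ennreal (\<phi> r powr q * (1 / r)) \<partial>\<pi>)
               + tsallis_div \<pi> q \<phi>)) \<and>
         (\<forall>a\<in>{0<..1}.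
            lower_TsVaR \<pi> q a =
            (INF \<phi>\<in>pos_densities_le \<pi> q a.
               ereal (a powr (q - 1)) * enn2ereal (\<integral>\<^sup>+ r. ennreal (\<phi> r powr q * (1 / r)) \<partial>\<pi>)))"
proof -
  have int: "integrable \<pi> (\<lambda>r. 1 / r)"
    using assms by (simp only: integrable_gamma_measure_inverse)
  interpret prob_space \<pi>
    using assms by (simp add: prob_space_gamma_measure)
  interpret tsallis_cost \<pi> "\<lambda>r. 1 / r" q
    by unfold_locales (use int assms in auto)
  have Z_eq: "(\<integral>r. qexp q (- l / r) \<partial>\<pi>) = Z l" for l
    by (simp add: Z_def)
  show ?thesis
    unfolding lower_TsVaR_def Z_eq cost_def[symmetric] dual_def[symmetric]
    using dual_eq_INF lower_TsVaR_eq_INF[OF int] by auto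
qed

end
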